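(* Let $\mathcal{H}_1,\mathcal{H}_2$ be real or complex Hilbert spaces, $M\subseteq\mathcal{H}_1$ and $N\subseteq\mathcal{H}_2$ closed subspaces, and let $T\in\mathcal{B}(\mathcal{H}_1,\mathcal{H}_2)$ have block form $T=\begin{pmatrix}A&B\\C&D\end{pmatrix}$ with respect to $\mathcal{H}_1=M\oplus M^\perp$ and $\mathcal{H}_2=N\oplus N^\perp$. Let $\lambda>0$ and assume that $T$ is $(M,N,\lambda)$-complementable. If the Schur complement $T_{/(M,N)}$ is bounded below on $M$, then $T$ is bounded below on $M$ and $$\frac{\gamma(T_{/(M,N)})}{1+\lambda}\,\|x\|\le\|Tx\|\quad\text{for all }x\in M.$$
   Context: $\mathcal{B}(\mathcal{H},\mathcal{K})$ is the space of bounded linear operators; $\mathcal{R}(\cdot)$ and $\mathcal{N}(\cdot)$ denote range and null space. Block entries: $A:M\to N$, $B:M^\perp\to N$, $C:M\to N^\perp$, $D:M^\perp\to N^\perp$, all bounded. For a closed subspace $W$, $\mathcal{B}_W=\{x\in W:\|x\|\le1\}$. For $\lambda>0$, $T$ is $(M,N,\lambda)$-complementable if $C(\mathcal{B}_M)\subseteq\lambda D(\mathcal{B}_{M^\perp})$ and $B^*(\mathcal{B}_N)\subseteq\lambda D^*(\mathcal{B}_{N^\perp})$; in particular $\mathcal{R}(C)\subseteq\mathcal{R}(D)$ and $\mathcal{R}(B^* )\subseteq\mathcal{R}(D^* )$. If $\mathcal{R}(A_1)\subseteq\mathcal{R}(B_1)$ for bounded operators $A_1,B_1$ with the same codomain,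 the Douglas reduced solution of $A_1=B_1X$ is the unique bounded $C_1$ with $A_1=B_1C_1$ and $\mathcal{R}(C_1)\subseteq\mathcal{N}(B_1)^\perp$. The Schur complement is $T_{/(M,N)}=\begin{pmatrix}A-BZ&0\\0&0\end{pmatrix}=\begin{pmatrix}A-YC&0\\0&0\end{pmatrix}$, where $Z$ is the Douglas reduced solution of $C=DX$ and $Y^*$ is the Douglas reduced solution of $B^*=D^*X$. An operator $S$ is bounded below on a subspace $W$ if there is $c>0$ with $\|Sx\|\ge c\|x\|$ for all $x\in W$. The reduced minimum modulus of $S$ is $\gamma(S)=\inf\{\|Sx\|:x\in\mathcal{N}(S)^\perp,\ \|x\|=1\}$. A vector $x\in M$ is identified with $(x,0)\in M\oplus M^\perp$. *)

theory Defs
  imports "HOL-Analysis.Analysis"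
begin

section \<open>Real or complex scalars\<close>

text \<open>
  A normed field with an additive map \<open>cj\<close> satisfying \<open>z * cj z = \<bar>z\<bar>\<^sup>2\<close> is the field of real
  numbers with the identity or the field of complex numbers with complex conjugation
  (see \<open>real_or_complex_dichotomy\<close> below), so a type of this class is the scalar field
  ``\<open>\<real>\<close> or \<open>\<complex>\<close>''.
\<close>

class real_or_complex = real_normed_field +
  fixes cj :: "'a \<Rightarrow> 'a"
  assumes cj_add: "cj (x + y) = cj x + cj y"
    and mult_cj_scaleR: "z * cj z = scaleR (norm z ^ 2) 1"

lemma mult_cj: "z * cj z = of_real ((norm z)\<^sup>2)" for z :: "'k :: real_or_complex"
  by (simp add: mult_cj_scaleR of_real_def)

instantiation real :: real_or_complex
begin
definition cj_real :: "real \<Rightarrow> real" where "cj_real x = x"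
instance by standard (auto simp: cj_real_def power2_eq_square)
end

instantiation complex :: real_or_complex
begin
definition cj_complex :: "complex \<Rightarrow> complex" where "cj_complex z = cnj z"
instance by standard (auto simp: cj_complex_def scaleR_conv_of_real simp flip: complex_norm_square)
end

lemma real_or_complex_dichotomy:
  "(\<forall>z :: 'k :: real_or_complex. z \<in> \<real>) \<or>
   (\<exists>i :: 'k. i * i = -1 \<and> cj i = - i \<and> (\<forall>z. \<exists>a b. z = of_real a + of_real b * i))"
proof (rule disjCI)
  assume "\<not> (\<exists>i :: 'k. i * i = -1 \<and> cj i = - i \<and> (\<forall>z. \<exists>a b. z = of_real a + of_real b * i))"
  then have no: "\<And>i :: 'k. i * i = -1 \<Longrightarrow> cj i = - i \<Longrightarrow>
      \<exists>z. \<forall>a b. z \<noteq> of_real a + of_real b * i" by blast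
  have cj0: "cj (0 :: 'k) = 0" using cj_add[of "0 :: 'k" 0] by simp
  have cj_eq: "cj z = of_real ((norm z)\<^sup>2) / z" if "z \<noteq> 0" for z :: 'k
    using mult_cj[of z] that by (simp add: field_simps)
  have cj_mult: "cj (x * y) = cj x * cj y" for x y :: 'k
    by (cases "x = 0 \<or> y = 0")
      (auto simp: cj0 cj_eq norm_mult power_mult_distrib)
  have cj_real: "cj (of_real r :: 'k) = of_real r" for r
    by (cases "r = 0") (auto simp: cj0 cj_eq power2_eq_square)
  have cj_minus: "cj (- z) = - cj z" for z :: 'k
    using cj_mult[of "of_real (-1)" z] cj_real[of "-1"] by simp
  have decomp: "\<exists>a w. z = of_real a + w \<and> cj w = - w" for z :: 'k
  proof -
    have "(z + 1) * cj (z + 1) = z * cj z + (z + cj z) + 1"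
      using cj_real[of 1] by (simp add: cj_add algebra_simps)
    then have "z + cj z = of_real ((norm (z + 1))\<^sup>2 - (norm z)\<^sup>2 - 1)"
      by (simp add: mult_cj algebra_simps)
    then obtain r where r: "z + cj z = of_real r" by blast
    then have c: "cj z = of_real r - z" by (simp add: algebra_simps)
    have "cj (z + of_real (- r / 2)) = - (z + of_real (- r / 2))"
      unfolding cj_add cj_real c by (simp add: algebra_simps flip: of_real_add)
    then show ?thesis
      by (intro exI[of _ "r / 2"] exI[of _ "z + of_real (- r / 2)"]) simp
  qed
  show "\<forall>z :: 'k. z \<in> \<real>"
  proof (rule ccontr)
    assume "\<not> (\<forall>z :: 'k. z \<in> \<real>)"
    then obtain z :: 'k where z: "z \<notin> \<real>" by blast
    obtain a w where w: "z = of_real a + w" "cj w = - w" using decomp by blast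
    have w0: "w \<noteq> 0" using z w by auto
    define i where "i = w * of_real (inverse (norm w))"
    have cji: "cj i = - i" by (simp only: i_def cj_mult cj_real w) simp
    have ni: "norm i = 1" using w0 by (simp add: i_def norm_mult norm_inverse)
    have ii: "i * i = -1" using mult_cj[of i] cji ni by (simp add: minus_equation_iff)
    have "\<exists>a b. y = of_real a + of_real b * i" for y :: 'k
    proof -
      obtain b v where v: "y = of_real b + v" "cj v = - v" using decomp by blast
      obtain c u where u: "v * i = of_real c + u" "cj u = - u" using decomp by blast
      have "cj (v * i) = v * i" by (simp add: cj_mult v cji)
      then have "u = 0"
        using u cj_add[of "of_real c" u] by (simp add: cj_real)
      then have "v * i * i = of_real c * i" using u by simp
      then have "v = of_real (- c) * i" by (simp add: mult.assoc ii) (metis minus_minus)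
      then show ?thesis using v by blast
    qed
    then show False using no[OF ii cji] by blast
  qed
qed


section \<open>Hilbert spaces and bounded operators\<close>

text \<open>
  Norm, topology and completeness come from the class \<open>banach\<close>; the inner product is linear in
  its first argument and induces that norm.
\<close>

locale hilbert_space = vector_space scale
  for scale :: "'k :: real_or_complex \<Rightarrow> 'v :: banach \<Rightarrow> 'v" +
  fixes ip :: "'v \<Rightarrow> 'v \<Rightarrow> 'k"
  assumes scale_of_real: "scale (of_real r) x = r *\<^sub>R x"
    and ip_add_left: "ip (x + y) z = ip x z + ip y z"
    and ip_scale_left: "ip (scale c x) y = c * ip x y"
    and ip_commute: "ip y x = cj (ip x y)"
    and ip_self: "ip x x = of_real ((norm x)\<^sup>2)"

lemma hilbert_space_real:
  "hilbert_space (scaleR :: real \<Rightarrow> 'a \<Rightarrow> 'a :: {real_inner, banach}) inner"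
  by unfold_locales
    (auto simp: algebra_simps inner_commute cj_real_def power2_norm_eq_inner)

lemma hilbert_space_complex: "hilbert_space (*) (\<lambda>x y :: complex. x * cnj y)"
  by unfold_locales
    (auto simp: algebra_simps cj_complex_def scaleR_conv_of_real complex_norm_square[symmetric]
      simp del: of_real_power)

definition closed_subspace ::
  "('k :: real_or_complex \<Rightarrow> 'v :: banach \<Rightarrow> 'v) \<Rightarrow> 'v set \<Rightarrow> bool" where
  "closed_subspace s W \<longleftrightarrow> module.subspace s W \<and> closed W"

definition bounded_op ::
  "('k :: real_or_complex \<Rightarrow> 'v :: banach \<Rightarrow> 'v) \<Rightarrow> ('k \<Rightarrow> 'w :: banach \<Rightarrow> 'w) \<Rightarrow>
   ('v \<Rightarrow> 'w) \<Rightarrow> bool" where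
  "bounded_op s1 s2 S \<longleftrightarrow> Vector_Spaces.linear s1 s2 S \<and> (\<exists>K. \<forall>x. norm (S x) \<le> K * norm x)"

definition orth_compl :: "('v \<Rightarrow> 'v \<Rightarrow> 'k :: zero) \<Rightarrow> 'v set \<Rightarrow> 'v set" where
  "orth_compl ip W = {x. \<forall>w\<in>W. ip x w = 0}"

definition orth_proj :: "('v :: minus \<Rightarrow> 'v \<Rightarrow> 'k :: zero) \<Rightarrow> 'v set \<Rightarrow> 'v \<Rightarrow> 'v" where
  "orth_proj ip W x = (THE p. p \<in> W \<and> x - p \<in> orth_compl ip W)"

definition adj ::
  "('v \<Rightarrow> 'v \<Rightarrow> 'k) \<Rightarrow> ('w \<Rightarrow> 'w \<Rightarrow> 'k) \<Rightarrow> ('v \<Rightarrow> 'w) \<Rightarrow> 'w \<Rightarrow> 'v" where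
  "adj ip1 ip2 S = (THE R. \<forall>x y. ip2 (S x) y = ip1 x (R y))"

definition null_space :: "('v \<Rightarrow> 'w :: zero) \<Rightarrow> 'v set" where
  "null_space S = {x. S x = 0}"

definition unit_ball :: "'v :: real_normed_vector set \<Rightarrow> 'v set" where
  "unit_ball W = {x \<in> W. norm x \<le> 1}"

definition bounded_below_on ::
  "('v :: real_normed_vector \<Rightarrow> 'w :: real_normed_vector) \<Rightarrow> 'v set \<Rightarrow> bool" where
  "bounded_below_on S W \<longleftrightarrow> (\<exists>c>0. \<forall>x\<in>W. norm (S x) \<ge> c * norm x)"

text \<open>
  For \<open>S = 0\<close> the infimum is over the empty set and has an unspecified real value.
\<close>

definition reduced_min_modulus ::
  "('v :: real_normed_vector \<Rightarrow> 'v \<Rightarrow> 'k :: zero) \<Rightarrow> ('v \<Rightarrow> 'w :: real_normed_vector) \<Rightarrow> real" where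
  "reduced_min_modulus ip S =
     Inf {norm (S x) | x. x \<in> orth_compl ip (null_space S) \<and> norm x = 1}"


section \<open>Blocks, complementability and the Schur complement\<close>

text \<open>
  The block of \<open>T\<close> from \<open>V\<close> to \<open>W\<close> is an operator on the whole space: it is extended by \<open>0\<close> on
  the orthogonal complement of \<open>V\<close>, and \<open>W\<close> is viewed inside the codomain of \<open>T\<close>. Adjoints and
  Douglas reduced solutions of blocks are compatible with this extension: the adjoint of the block
  from \<open>V\<close> to \<open>W\<close> is the zero extension of the adjoint \<open>W \<rightarrow> V\<close>, and since a block vanishes
  on the orthogonal complement of \<open>V\<close>, the orthogonal complement of its null space lies in \<open>V\<close>.
\<close>

definition op_block ::
  "('v :: minus \<Rightarrow> 'v \<Rightarrow> 'k :: zero) \<Rightarrow> ('w :: minus \<Rightarrow> 'w \<Rightarrow> 'k) \<Rightarrow> 'v set \<Rightarrow> 'w set \<Rightarrow>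
   ('v \<Rightarrow> 'w) \<Rightarrow> 'v \<Rightarrow> 'w" where
  "op_block ip1 ip2 V W T = orth_proj ip2 W \<circ> T \<circ> orth_proj ip1 V"

definition complementable ::
  "('v :: real_normed_vector \<Rightarrow> 'v \<Rightarrow> 'k :: zero) \<Rightarrow> ('w :: real_normed_vector \<Rightarrow> 'w \<Rightarrow> 'k) \<Rightarrow>
   'v set \<Rightarrow> 'w set \<Rightarrow> real \<Rightarrow> ('v \<Rightarrow> 'w) \<Rightarrow> bool" where
  "complementable ip1 ip2 M N lam T \<longleftrightarrow>
    (let M' = orth_compl ip1 M; N' = orth_compl ip2 N;
         B = op_block ip1 ip2 M' N T;
         C = op_block ip1 ip2 M N' T;
         D = op_block ip1 ip2 M' N' T
     in C ` unit_ball M \<subseteq> (\<lambda>y. lam *\<^sub>R y) ` D ` unit_ball M' \<and>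
        adj ip1 ip2 B ` unit_ball N \<subseteq> (\<lambda>y. lam *\<^sub>R y) ` adj ip1 ip2 D ` unit_ball N')"

text \<open>
  The Douglas reduced solution of \<open>A\<^sub>1 = B\<^sub>1 X\<close>; \<open>s0\<close> and \<open>s1\<close> are the scalar multiplications
  on the domains of \<open>A\<^sub>1\<close> and \<open>B\<^sub>1\<close>, and \<open>ip1\<close> is the inner product on the domain of \<open>B\<^sub>1\<close>.
\<close>

definition douglas_solution ::
  "('k :: real_or_complex \<Rightarrow> 'u :: banach \<Rightarrow> 'u) \<Rightarrow> ('k \<Rightarrow> 'v :: banach \<Rightarrow> 'v) \<Rightarrow>
   ('v \<Rightarrow> 'v \<Rightarrow> 'k) \<Rightarrow> ('u \<Rightarrow> 'w :: zero) \<Rightarrow> ('v \<Rightarrow> 'w) \<Rightarrow> 'u \<Rightarrow> 'v" where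
  "douglas_solution s0 s1 ip1 A1 B1 =
    (THE X. bounded_op s0 s1 X \<and> A1 = B1 \<circ> X \<and> range X \<subseteq> orth_compl ip1 (null_space B1))"

text \<open>
  The Schur complement \<open>A - B Z\<close>, where \<open>Z\<close> is the Douglas reduced solution of \<open>C = D X\<close>;
  for complementable \<open>T\<close> it equals \<open>A - Y C\<close>, where \<open>Y\<close> is the adjoint of the Douglas reduced
  solution of \<open>B\<^sup>* = D\<^sup>* X\<close>.
\<close>

definition schur_complement ::
  "('k :: real_or_complex \<Rightarrow> 'v :: banach \<Rightarrow> 'v) \<Rightarrow> ('v \<Rightarrow> 'v \<Rightarrow> 'k) \<Rightarrow>
   ('w :: banach \<Rightarrow> 'w \<Rightarrow> 'k) \<Rightarrow> 'v set \<Rightarrow> 'w set \<Rightarrow> ('v \<Rightarrow> 'w) \<Rightarrow> 'v \<Rightarrow> 'w" where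
  "schur_complement s1 ip1 ip2 M N T =
    (let M' = orth_compl ip1 M; N' = orth_compl ip2 N;
         A = op_block ip1 ip2 M N T;
         B = op_block ip1 ip2 M' N T;
         C = op_block ip1 ip2 M N' T;
         D = op_block ip1 ip2 M' N' T;
         Z = douglas_solution s1 s1 ip1 C D
     in (\<lambda>x. A x - B (Z x)))"

end

theory Submission
  imports Defs
begin

text \<open>
  For \<open>x \<in> M\<close> the components of \<open>T x\<close> in \<open>N\<close> and in its orthogonal complement are \<open>A x\<close> and
  \<open>C x\<close>, so both have norm at most \<open>\<parallel>T x\<parallel>\<close>. The Schur complement is \<open>A x - B (Z x)\<close> with
  \<open>D (Z x) = C x\<close>, and everything rests on the estimate \<open>\<parallel>B (Z x)\<parallel> \<le> \<lambda> \<parallel>C x\<parallel>\<close>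
  (\<open>norm_block_douglas_le\<close>). It is a duality argument: complementability writes
  \<open>B\<^sup>* y = \<lambda> D\<^sup>* w\<close> with \<open>w\<close> in the unit ball for each \<open>y\<close> in the unit ball of \<open>N\<close>, and then
  \<open>\<langle>B (Z x), y\<rangle> = \<lambda> \<langle>D (Z x), w\<rangle> = \<lambda> \<langle>C x, w\<rangle>\<close>. Hence \<open>\<parallel>S x\<parallel> \<le> (1 + \<lambda>) \<parallel>T x\<parallel>\<close> on \<open>M\<close>, where \<open>S\<close> is the
  Schur complement, which gives the first claim.

  For the constant, \<open>S\<close> vanishes on the orthogonal complement of \<open>M\<close> and is injective on \<open>M\<close>, so
  \<open>M\<close> is contained in the orthogonal complement of the null space of \<open>S\<close>, and there
  \<open>\<parallel>S x\<parallel> \<ge> \<gamma>(S) \<parallel>x\<parallel>\<close>.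

  The adjoints, projections and Douglas reduced solutions are given by definite descriptions, so
  their existence has to be established over either scalar field: projections by minimising the
  distance, adjoints by Riesz representation. The Douglas reduced solution is bounded without an
  appeal to the closed graph theorem, because the inclusion of \<open>C\<close> of the unit ball in \<open>\<lambda> D\<close> of the unit ball
  supplies preimages of controlled norm.
\<close>

section \<open>Conjugation\<close>

lemma cj_0 [simp]: "cj (0 :: 'k :: real_or_complex) = 0"
  using cj_add[of "0 :: 'k" 0] by simp

lemma cj_eq_divide: "z \<noteq> 0 \<Longrightarrow> cj z = of_real ((norm z)\<^sup>2) / z" for z :: "'k :: real_or_complex"
  using mult_cj[of z] by (simp add: field_simps)

lemma cj_mult: "cj (x * y) = cj x * cj y" for x y :: "'k :: real_or_complex"
  by (cases "x = 0 \<or> y = 0") (auto simp: cj_eq_divide norm_mult power_mult_distrib)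

lemma cj_of_real [simp]: "cj (of_real r :: 'k :: real_or_complex) = of_real r"
  by (cases "r = 0") (auto simp: cj_eq_divide power2_eq_square)

lemma norm_cj [simp]: "norm (cj z) = norm z" for z :: "'k :: real_or_complex"
  by (cases "z = 0") (auto simp: cj_eq_divide norm_divide norm_mult power2_eq_square)

lemma cj_cj [simp]: "cj (cj z) = z" for z :: "'k :: real_or_complex"
proof (cases "z = 0")
  case False
  then have "cj z \<noteq> 0" by (metis norm_cj norm_eq_zero)
  with False show ?thesis
    by (simp add: cj_eq_divide[of "cj z"]) (simp add: cj_eq_divide)
qed simp

section \<open>Inner products, projections and Riesz representation\<close>

context hilbert_space
begin

lemma ip_add_right: "ip x (y + z) = ip x y + ip x z"
  by (metis ip_commute ip_add_left cj_add)

lemma ip_scale_right: "ip x (scale c y) = cj c * ip x y"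
  by (metis ip_commute ip_scale_left cj_mult)

lemma ip_zero_left [simp]: "ip 0 y = 0"
  using ip_add_left[of 0 0 y] by simp

lemma ip_zero_right [simp]: "ip x 0 = 0"
  using ip_add_right[of x 0 0] by simp

lemma ip_diff_left: "ip (x - y) z = ip x z - ip y z"
  using ip_add_left[of "x - y" y z] by (simp add: algebra_simps)

lemma ip_diff_right: "ip x (y - z) = ip x y - ip x z"
  using ip_add_right[of x "y - z" z] by (simp add: algebra_simps)

lemma ip_scaleR_left: "ip (r *\<^sub>R x) y = of_real r * ip x y"
  by (metis scale_of_real ip_scale_left)

lemma ip_scaleR_right: "ip x (r *\<^sub>R y) = of_real r * ip x y"
  by (metis scale_of_real ip_scale_right cj_of_real)

lemma ip_eq_0_sym: "ip x y = 0 \<Longrightarrow> ip y x = 0"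
  by (metis ip_commute cj_0)

lemma ip_self_eq_0 [simp]: "ip x x = 0 \<longleftrightarrow> x = 0"
  by (simp add: ip_self)

lemma norm_scale: "norm (scale c x) = norm c * norm x"
proof -
  have "of_real ((norm (scale c x))\<^sup>2) = (c * cj c) * ip x x"
    by (simp only: ip_self[symmetric] ip_scale_left ip_scale_right mult_ac)
  also have "\<dots> = of_real ((norm c * norm x)\<^sup>2)"
    by (simp only: mult_cj ip_self power_mult_distrib of_real_mult)
  finally have "of_real ((norm (scale c x))\<^sup>2) = (of_real ((norm c * norm x)\<^sup>2) :: 'k)" .
  then have "(norm (scale c x))\<^sup>2 = (norm c * norm x)\<^sup>2"
    by (simp only: of_real_eq_iff)
  then show ?thesis by (simp add: power2_eq_iff_nonneg)
qed

lemma norm_add_Pythagoras: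
  assumes "ip x y = 0"
  shows "(norm (x + y))\<^sup>2 = (norm x)\<^sup>2 + (norm y)\<^sup>2"
proof -
  have "of_real ((norm (x + y))\<^sup>2) = (of_real ((norm x)\<^sup>2 + (norm y)\<^sup>2) :: 'k)"
    using assms ip_eq_0_sym[OF assms]
    by (simp only: ip_self[symmetric] ip_add_left ip_add_right of_real_add) simp
  then show ?thesis by (simp only: of_real_eq_iff)
qed

lemma parallelogram:
  fixes x y :: 'v
  shows "(norm (x + y))\<^sup>2 + (norm (x - y))\<^sup>2 = 2 * (norm x)\<^sup>2 + 2 * (norm y)\<^sup>2"
proof -
  have "ip (x + y) (x + y) + ip (x - y) (x - y) = 2 * ip x x + 2 * ip y y"
    by (simp add: ip_add_left ip_add_right ip_diff_left ip_diff_right)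
  then have "of_real ((norm (x + y))\<^sup>2 + (norm (x - y))\<^sup>2)
      = (of_real (2 * (norm x)\<^sup>2 + 2 * (norm y)\<^sup>2) :: 'k)"
    by (simp add: ip_self)
  then show ?thesis by (simp only: of_real_eq_iff)
qed

text \<open>
  Subtracting from \<open>u\<close> its component along \<open>w\<close> shortens \<open>u\<close> by an explicit amount. Nonnegativity of
  the left side is the Cauchy--Schwarz inequality; and if no multiple of \<open>w\<close> brings \<open>u\<close> closer to
  the origin, then \<open>u\<close> and \<open>w\<close> are orthogonal.
\<close>

lemma norm_minus_component:
  assumes "w \<noteq> 0"
  shows "(norm (u - scale (ip u w / of_real ((norm w)\<^sup>2)) w))\<^sup>2
    = (norm u)\<^sup>2 - (norm (ip u w))\<^sup>2 / (norm w)\<^sup>2"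
proof -
  define v where "v = scale (ip u w / of_real ((norm w)\<^sup>2)) w"
  have n: "norm v = norm (ip u w) / norm w"
    using assms by (simp add: v_def norm_scale norm_divide norm_mult power2_eq_square)
  have "ip (u - v) w = 0"
    using assms by (simp add: v_def ip_diff_left ip_scale_left ip_self)
  then have "ip (u - v) v = 0"
    by (simp add: v_def ip_scale_right)
  from norm_add_Pythagoras[OF this] show ?thesis
    by (simp add: n power_divide del: of_real_power flip: v_def)
qed

lemma Cauchy_Schwarz: "norm (ip x y) \<le> norm x * norm y"
proof (cases "y = 0")
  case False
  have "0 \<le> (norm x)\<^sup>2 - (norm (ip x y))\<^sup>2 / (norm y)\<^sup>2"
    by (subst norm_minus_component[OF False, symmetric]) simp
  then have "(norm (ip x y))\<^sup>2 \<le> (norm x * norm y)\<^sup>2"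
    using False by (simp add: field_simps power_mult_distrib)
  then show ?thesis by (rule power2_le_imp_le) simp
qed simp

lemma bounded_linear_ip_left: "bounded_linear (\<lambda>x. ip x y)"
  by (rule bounded_linear_intro[where K = "norm y"])
    (auto simp: ip_add_left ip_scaleR_left scaleR_conv_of_real Cauchy_Schwarz)

lemma closed_subspace_orth_compl: "closed_subspace scale (orth_compl ip W)"
proof -
  have "orth_compl ip W = (\<Inter>w\<in>W. (\<lambda>x. ip x w) -` {0})"
    by (auto simp: orth_compl_def)
  moreover have "closed ((\<lambda>x. ip x w) -` {0})" for w
    by (intro continuous_closed_vimage) (auto intro: bounded_linear.isCont[OF bounded_linear_ip_left])
  ultimately have "closed (orth_compl ip W)" by auto
  moreover have "subspace (orth_compl ip W)"
    by (rule subspaceI) (auto simp: orth_compl_def ip_add_left ip_scale_left)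
  ultimately show ?thesis by (simp add: closed_subspace_def)
qed

lemma closed_subspace_scaleR: "closed_subspace scale W \<Longrightarrow> x \<in> W \<Longrightarrow> r *\<^sub>R x \<in> W"
  unfolding closed_subspace_def by (metis scale_of_real subspace_scale)

text \<open>
  A sequence in \<open>W\<close> that minimises the distance to \<open>x\<close> is Cauchy by the parallelogram identity, as
  the midpoint of two of its terms lies in \<open>W\<close>; its limit attains the minimum.
\<close>

lemma nearest_point_exists:
  assumes W: "closed_subspace scale W"
  shows "\<exists>p\<in>W. \<forall>w\<in>W. norm (x - p) \<le> norm (x - w)"
proof -
  have sub: "subspace W" and cl: "closed W" using W by (auto simp: closed_subspace_def)
  define E where "E = (\<lambda>w. (norm (x - w))\<^sup>2) ` W"
  define d where "d = Inf E"
  have ne: "E \<noteq> {}" using subspace_0[OF sub] by (auto simp: E_def)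
  have bdd: "bdd_below E" by (rule bdd_belowI[of _ 0]) (auto simp: E_def)
  have lower: "d \<le> (norm (x - w))\<^sup>2" if "w \<in> W" for w
    unfolding d_def by (rule cInf_lower[OF _ bdd]) (auto simp: E_def that)
  have "\<exists>w\<in>W. (norm (x - w))\<^sup>2 < d + inverse (real (Suc n))" for n
    using cInf_lessD[OF ne, of "d + inverse (real (Suc n))"] unfolding d_def[symmetric]
    by (auto simp: E_def)
  then obtain f where f: "\<And>n. f n \<in> W" "\<And>n. (norm (x - f n))\<^sup>2 < d + inverse (real (Suc n))"
    by metis
  have close: "(norm (f m - f n))\<^sup>2 \<le> 2 * inverse (real (Suc m)) + 2 * inverse (real (Suc n))" for m n
  proof -
    have "(1/2) *\<^sub>R (f m + f n) \<in> W"
      using W f by (intro closed_subspace_scaleR) (auto simp: subspace_add[OF sub])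
    from lower[OF this] have "d \<le> (norm (x - (1/2) *\<^sub>R (f m + f n)))\<^sup>2" .
    moreover have "(x - f m) + (x - f n) = 2 *\<^sub>R (x - (1/2) *\<^sub>R (f m + f n))"
      by (simp add: algebra_simps scaleR_2)
    then have "(norm ((x - f m) + (x - f n)))\<^sup>2 = 4 * (norm (x - (1/2) *\<^sub>R (f m + f n)))\<^sup>2"
      by (simp add: power_mult_distrib)
    moreover have "(x - f m) - (x - f n) = f n - f m" by simp
    ultimately show ?thesis
      using parallelogram[of "x - f m" "x - f n"] f(2)[of m] f(2)[of n]
      by (simp add: norm_minus_commute)
  qed
  have "Cauchy f"
  proof (rule CauchyI)
    fix e :: real assume e: "e > 0"
    then obtain k where k: "inverse (real (Suc k)) < e\<^sup>2 / 4"
      using reals_Archimedean[of "e\<^sup>2 / 4"] by auto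
    have "norm (f m - f n) < e" if "m \<ge> k" "n \<ge> k" for m n
    proof -
      have "inverse (real (Suc m)) \<le> inverse (real (Suc k))"
        "inverse (real (Suc n)) \<le> inverse (real (Suc k))"
        using that by (auto intro!: le_imp_inverse_le)
      then have "(norm (f m - f n))\<^sup>2 < e\<^sup>2" using close[of m n] k by linarith
      then show ?thesis using e by (simp add: power2_less_imp_less)
    qed
    then show "\<exists>k. \<forall>m\<ge>k. \<forall>n\<ge>k. norm (f m - f n) < e" by blast
  qed
  then obtain p where p: "f \<longlonglongrightarrow> p" by (auto simp: Cauchy_convergent_iff convergent_def)
  have "p \<in> W" using closed_sequentially[OF cl _ p] f by blast
  have "(\<lambda>n. (norm (x - f n))\<^sup>2) \<longlonglongrightarrow> (norm (x - p))\<^sup>2" by (intro tendsto_intros p)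
  moreover have "(\<lambda>n. d + inverse (real (Suc n))) \<longlonglongrightarrow> d"
    using tendsto_add[OF tendsto_const LIMSEQ_inverse_real_of_nat, of d] by simp
  ultimately have "(norm (x - p))\<^sup>2 \<le> d"
    by (rule LIMSEQ_le) (use f in \<open>auto intro: less_imp_le\<close>)
  then have "norm (x - p) \<le> norm (x - w)" if "w \<in> W" for w
    using lower[OF that] by (meson norm_ge_zero order_trans power2_le_imp_le)
  with \<open>p \<in> W\<close> show ?thesis by blast
qed

lemma orth_decomposition_exists:
  assumes W: "closed_subspace scale W"
  shows "\<exists>p\<in>W. x - p \<in> orth_compl ip W"
proof -
  have sub: "subspace W" using W by (auto simp: closed_subspace_def)
  obtain p where p: "p \<in> W" "\<And>w. w \<in> W \<Longrightarrow> norm (x - p) \<le> norm (x - w)"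
    using nearest_point_exists[OF W] by blast
  have "ip (x - p) w = 0" if w: "w \<in> W" for w
  proof (cases "w = 0")
    case False
    define v where "v = scale (ip (x - p) w / of_real ((norm w)\<^sup>2)) w"
    have "p + v \<in> W" unfolding v_def by (intro subspace_add[OF sub] p subspace_scale[OF sub] w)
    then have "norm (x - p) \<le> norm (x - p - v)" using p(2) by (simp add: algebra_simps)
    then have "(norm (x - p))\<^sup>2 \<le> (norm (x - p - v))\<^sup>2" by (simp add: power_mono)
    also have "\<dots> = (norm (x - p))\<^sup>2 - (norm (ip (x - p) w))\<^sup>2 / (norm w)\<^sup>2"
      unfolding v_def by (rule norm_minus_component[OF False])
    finally show ?thesis using False by (simp add: divide_le_0_iff)
  qed simp
  then show ?thesis using p by (auto simp: orth_compl_def)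
qed

lemma orth_compl_Int: "x \<in> W \<Longrightarrow> x \<in> orth_compl ip W \<Longrightarrow> x = 0"
  by (auto simp: orth_compl_def)

lemma orth_proj_eqI:
  assumes W: "closed_subspace scale W" and "p \<in> W" "x - p \<in> orth_compl ip W"
  shows "orth_proj ip W x = p"
  unfolding orth_proj_def
proof (rule the_equality)
  fix q assume q: "q \<in> W \<and> x - q \<in> orth_compl ip W"
  have sub: "subspace W" "subspace (orth_compl ip W)"
    using W closed_subspace_orth_compl by (auto simp: closed_subspace_def)
  have "q - p \<in> W" using q assms by (auto intro: subspace_diff[OF sub(1)])
  moreover have "(x - p) - (x - q) \<in> orth_compl ip W"
    using q assms(3) by (blast intro: subspace_diff[OF sub(2)])
  ultimately show "q = p" using orth_compl_Int[of "q - p" W] by simp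
qed (use assms in auto)

lemma
  assumes W: "closed_subspace scale W"
  shows orth_proj_in: "orth_proj ip W x \<in> W"
    and orth_proj_residual: "x - orth_proj ip W x \<in> orth_compl ip W"
  using orth_decomposition_exists[OF W, of x] orth_proj_eqI[OF W] by metis+

lemma orth_proj_id: "closed_subspace scale W \<Longrightarrow> x \<in> W \<Longrightarrow> orth_proj ip W x = x"
  by (rule orth_proj_eqI) (auto simp: orth_compl_def)

lemma orth_proj_0: "closed_subspace scale W \<Longrightarrow> x \<in> orth_compl ip W \<Longrightarrow> orth_proj ip W x = 0"
  by (rule orth_proj_eqI) (auto simp: closed_subspace_def subspace_0)

lemma norm_orth_proj_le:
  assumes W: "closed_subspace scale W"
  shows "norm (orth_proj ip W x) \<le> norm x"
proof -
  have "ip (x - orth_proj ip W x) (orth_proj ip W x) = 0"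
    using orth_proj_residual[OF W, of x] orth_proj_in[OF W, of x] by (simp add: orth_compl_def)
  from norm_add_Pythagoras[OF this] have "(norm (orth_proj ip W x))\<^sup>2 \<le> (norm x)\<^sup>2" by simp
  then show ?thesis by (rule power2_le_imp_le) simp
qed

lemma orth_proj_orth_compl:
  assumes W: "closed_subspace scale W"
  shows "orth_proj ip (orth_compl ip W) x = x - orth_proj ip W x"
proof (rule orth_proj_eqI[OF closed_subspace_orth_compl orth_proj_residual[OF W]])
  show "x - (x - orth_proj ip W x) \<in> orth_compl ip (orth_compl ip W)"
    using orth_proj_in[OF W, of x] by (auto simp: orth_compl_def intro: ip_eq_0_sym)
qed

lemma bounded_op_orth_proj:
  assumes W: "closed_subspace scale W"
  shows "bounded_op scale scale (orth_proj ip W)"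
proof -
  have sub: "subspace W" "subspace (orth_compl ip W)"
    using W closed_subspace_orth_compl by (auto simp: closed_subspace_def)
  have "orth_proj ip W (x + y) = orth_proj ip W x + orth_proj ip W y" for x y
    using subspace_add[OF sub(2) orth_proj_residual[OF W] orth_proj_residual[OF W], of x y]
    by (intro orth_proj_eqI[OF W] subspace_add[OF sub(1)] orth_proj_in[OF W])
      (simp add: algebra_simps)
  moreover have "orth_proj ip W (scale c x) = scale c (orth_proj ip W x)" for c x
    using subspace_scale[OF sub(2) orth_proj_residual[OF W], of c x]
    by (intro orth_proj_eqI[OF W] subspace_scale[OF sub(1)] orth_proj_in[OF W])
      (simp add: scale_right_diff_distrib)
  moreover have "\<exists>K. \<forall>x. norm (orth_proj ip W x) \<le> K * norm x"
    using norm_orth_proj_le[OF W] by (intro exI[of _ 1]) simp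
  ultimately show ?thesis
    by (simp add: bounded_op_def Vector_Spaces.linear_iff vector_space_axioms)
qed

text \<open>
  A nonzero functional is determined by its value at one vector \<open>z\<close> orthogonal to its null space,
  because \<open>x\<close> and the multiple \<open>(f x / f z) z\<close> differ by a null vector; so a suitable multiple of
  \<open>z\<close> represents it.
\<close>

lemma Riesz_representation:
  fixes f :: "'v \<Rightarrow> 'k"
  assumes add: "\<And>x y. f (x + y) = f x + f y" and scl: "\<And>c x. f (scale c x) = c * f x"
    and bound: "\<And>x. norm (f x) \<le> K * norm x"
  shows "\<exists>r. \<forall>x. f x = ip x r"
proof (cases "\<forall>x. f x = 0")
  case True
  then show ?thesis by (intro exI[of _ 0]) simp
next
  case False
  then obtain a where a: "f a \<noteq> 0" by blast
  have "f (r *\<^sub>R x) = r *\<^sub>R f x" for r x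
    using scl[of "of_real r" x] by (simp add: scale_of_real scaleR_conv_of_real)
  then have bl: "bounded_linear f"
    by (intro bounded_linear_intro[where K = K]) (auto simp: add bound mult.commute)
  have f0: "f 0 = 0" using add[of 0 0] by simp
  have fdiff: "f (x - y) = f x - f y" for x y
    using add[of "x - y" y] by (simp add: algebra_simps)
  have "closed (f -` {0})"
    by (intro continuous_closed_vimage) (auto intro: bounded_linear.isCont[OF bl])
  moreover have "null_space f = f -` {0}" by (auto simp: null_space_def)
  moreover have "subspace (null_space f)"
    by (rule subspaceI) (auto simp: null_space_def add scl f0)
  ultimately have "closed_subspace scale (null_space f)" by (simp add: closed_subspace_def)
  then obtain p where p: "f p = 0" "a - p \<in> orth_compl ip (null_space f)"
    using orth_decomposition_exists[of "null_space f" a] by (auto simp: null_space_def)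
  define z where "z = a - p"
  have fz: "f z \<noteq> 0" using a p by (simp add: z_def fdiff)
  then have z0: "z \<noteq> 0" using f0 by auto
  have "f x = ip x (scale (cj (f z) / of_real ((norm z)\<^sup>2)) z)" for x
  proof -
    have "f (x - scale (f x / f z) z) = 0" using fz by (simp add: fdiff scl)
    then have "ip z (x - scale (f x / f z) z) = 0"
      using p(2) by (simp add: z_def orth_compl_def null_space_def)
    from ip_eq_0_sym[OF this] have "ip x z = f x / f z * of_real ((norm z)\<^sup>2)"
      by (simp add: ip_diff_left ip_scale_left ip_self)
    moreover have "cj (cj (f z) / of_real ((norm z)\<^sup>2)) = f z / of_real ((norm z)\<^sup>2)"
      using cj_mult[of "cj (f z)" "of_real (inverse ((norm z)\<^sup>2))"]
      by (simp only: cj_cj cj_of_real divide_inverse flip: of_real_inverse)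
    ultimately show ?thesis using fz z0 by (simp add: ip_scale_right)
  qed
  then show ?thesis by blast
qed

lemma mem_double_orth_compl: "x \<in> W \<Longrightarrow> x \<in> orth_compl ip (orth_compl ip W)"
  by (auto simp: orth_compl_def intro: ip_eq_0_sym)

lemma reduced_min_modulus_le:
  fixes S :: "'v \<Rightarrow> 'w :: real_normed_vector"
  assumes x: "x \<in> orth_compl ip (null_space S)"
    and hom: "\<And>r. S (r *\<^sub>R x) = r *\<^sub>R S x"
  shows "reduced_min_modulus ip S * norm x \<le> norm (S x)"
proof (cases "x = 0")
  case False
  define E where "E = {norm (S u) | u. u \<in> orth_compl ip (null_space S) \<and> norm u = 1}"
  have "inverse (norm x) *\<^sub>R x \<in> orth_compl ip (null_space S)"
    using x closed_subspace_orth_compl by (auto intro: closed_subspace_scaleR)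
  moreover have "norm (inverse (norm x) *\<^sub>R x) = 1" using False by simp
  ultimately have "norm (S (inverse (norm x) *\<^sub>R x)) \<in> E" unfolding E_def by blast
  then have "norm (S x) / norm x \<in> E" by (simp add: hom divide_inverse mult.commute)
  then have "Inf E \<le> norm (S x) / norm x"
    by (rule cInf_lower) (auto intro!: bdd_belowI[of _ 0] simp: E_def)
  then show ?thesis using False by (simp add: reduced_min_modulus_def E_def field_simps)
qed simp

end

section \<open>Bounded operators, adjoints and Douglas reduced solutions\<close>

lemma
  assumes "bounded_op s1 s2 S"
  shows bounded_op_add: "S (x + y) = S x + S y"
    and bounded_op_scale: "S (s1 c x) = s2 c (S x)"
  using assms by (auto simp: bounded_op_def Vector_Spaces.linear_iff)

lemma bounded_op_zero: "bounded_op s1 s2 S \<Longrightarrow> S 0 = 0"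
  using bounded_op_add[of s1 s2 S 0 0] by simp

lemma bounded_op_diff: "bounded_op s1 s2 S \<Longrightarrow> S (x - y) = S x - S y"
  using bounded_op_add[of s1 s2 S "x - y" y] by (simp add: algebra_simps)

lemma bounded_op_obtain_bound:
  assumes "bounded_op s1 s2 S"
  obtains K where "K \<ge> 0" "\<And>x. norm (S x) \<le> K * norm x"
proof -
  obtain K where K: "\<And>x. norm (S x) \<le> K * norm x" using assms by (auto simp: bounded_op_def)
  have "norm (S x) \<le> max K 0 * norm x" for x
    using K[of x] mult_right_mono[of K "max K 0" "norm x"] by simp
  then show ?thesis using that[of "max K 0"] by simp
qed

lemma bounded_op_compose:
  assumes R: "bounded_op s2 s3 R" and S: "bounded_op s1 s2 S"
  shows "bounded_op s1 s3 (R \<circ> S)"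
proof -
  obtain K L where K: "K \<ge> 0" "\<And>x. norm (R x) \<le> K * norm x" and L: "\<And>x. norm (S x) \<le> L * norm x"
    by (metis bounded_op_obtain_bound R S)
  have "norm (R (S x)) \<le> K * L * norm x" for x
    using K(2)[of "S x"] mult_left_mono[OF L K(1), of x] by (simp add: mult.assoc)
  then show ?thesis using R S by (auto simp: bounded_op_def Vector_Spaces.linear_iff)
qed

locale hilbert_space_pair = dom: hilbert_space s1 ip1 + cod: hilbert_space s2 ip2
  for s1 :: "'k :: real_or_complex \<Rightarrow> 'a :: banach \<Rightarrow> 'a" and ip1 :: "'a \<Rightarrow> 'a \<Rightarrow> 'k"
    and s2 :: "'k \<Rightarrow> 'b :: banach \<Rightarrow> 'b" and ip2 :: "'b \<Rightarrow> 'b \<Rightarrow> 'k"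
begin

lemma bounded_op_scaleR: "bounded_op s1 s2 S \<Longrightarrow> S (r *\<^sub>R x) = r *\<^sub>R S x"
  by (metis bounded_op_scale dom.scale_of_real cod.scale_of_real)

lemma bounded_op_op_block:
  assumes "closed_subspace s1 V" "closed_subspace s2 W" "bounded_op s1 s2 S"
  shows "bounded_op s1 s2 (op_block ip1 ip2 V W S)"
  unfolding op_block_def
  by (rule bounded_op_compose[OF bounded_op_compose[OF cod.bounded_op_orth_proj[OF assms(2)] assms(3)]
        dom.bounded_op_orth_proj[OF assms(1)]])

lemma closed_subspace_null_space:
  assumes S: "bounded_op s1 s2 S"
  shows "closed_subspace s1 (null_space S)"
proof -
  obtain K where K: "\<And>x. norm (S x) \<le> K * norm x" by (metis bounded_op_obtain_bound S)
  have bl: "bounded_linear S"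
    by (rule bounded_linear_intro[where K = K])
      (auto simp: bounded_op_add[OF S] bounded_op_scaleR[OF S] K mult.commute)
  have "closed (S -` {0})"
    by (intro continuous_closed_vimage) (auto intro: bounded_linear.isCont[OF bl])
  moreover have "null_space S = S -` {0}" by (auto simp: null_space_def)
  moreover have "dom.subspace (null_space S)"
    by (rule dom.subspaceI)
      (auto simp: null_space_def bounded_op_zero[OF S] bounded_op_add[OF S] bounded_op_scale[OF S])
  ultimately show ?thesis by (simp add: closed_subspace_def)
qed

lemma ip_adj:
  assumes S: "bounded_op s1 s2 S"
  shows "ip2 (S x) y = ip1 x (adj ip1 ip2 S y)"
proof -
  obtain K where K: "\<And>x. norm (S x) \<le> K * norm x" by (metis bounded_op_obtain_bound S)
  have "\<exists>r. \<forall>x. ip2 (S x) y = ip1 x r" for y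
  proof (rule dom.Riesz_representation)
    show "norm (ip2 (S x) y) \<le> K * norm y * norm x" for x
      using cod.Cauchy_Schwarz[of "S x" y] mult_right_mono[OF K[of x], of "norm y"]
      by (simp add: algebra_simps)
  qed (auto simp: bounded_op_add[OF S] bounded_op_scale[OF S] cod.ip_add_left cod.ip_scale_left)
  then obtain R where R: "\<forall>x y. ip2 (S x) y = ip1 x (R y)" by metis
  have "R' = R" if R': "\<forall>x y. ip2 (S x) y = ip1 x (R' y)" for R'
  proof
    fix y
    have "ip1 (R' y - R y) (R' y - R y) = 0"
      using R R' by (simp add: dom.ip_diff_right)
    then show "R' y = R y" by simp
  qed
  then have "adj ip1 ip2 S = R" unfolding adj_def using R by (intro the_equality) blast+
  with R show ?thesis by simp
qed

text \<open>
  The reduced solution sends \<open>x\<close> to the unique preimage of \<open>C x\<close> under \<open>D\<close> that is orthogonal to the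
  null space of \<open>D\<close>. Linearity follows from uniqueness, and since this preimage is the projection of
  every other one, a norm bound on some preimages is a norm bound on the solution.
\<close>

lemma douglas_solution_properties:
  assumes C: "bounded_op s1 s2 C" and D: "bounded_op s1 s2 D"
    and pre: "\<And>x. \<exists>z. D z = C x \<and> norm z \<le> L * norm x"
  defines "Z \<equiv> douglas_solution s1 s1 ip1 C D"
  shows "bounded_op s1 s1 Z" "\<And>x. D (Z x) = C x" "\<And>x. Z x \<in> orth_compl ip1 (null_space D)"
proof -
  let ?O = "orth_compl ip1 (null_space D)"
  note cl = closed_subspace_null_space[OF D]
  have subO: "dom.subspace ?O"
    using dom.closed_subspace_orth_compl by (simp add: closed_subspace_def)
  have uniq: "u = v" if "u \<in> ?O" "v \<in> ?O" "D u = D v" for u v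
  proof -
    have "u - v \<in> ?O" using that subO by (simp add: dom.subspace_diff)
    moreover have "u - v \<in> null_space D" using that by (simp add: null_space_def bounded_op_diff[OF D])
    ultimately show ?thesis using dom.orth_compl_Int by fastforce
  qed
  have "\<exists>z. z \<in> ?O \<and> D z = C x \<and> norm z \<le> L * norm x" for x
  proof -
    obtain z where z: "D z = C x" "norm z \<le> L * norm x" using pre by blast
    have "D (orth_proj ip1 (null_space D) z) = 0"
      using dom.orth_proj_in[OF cl, of z] by (simp add: null_space_def)
    then have "D (orth_proj ip1 ?O z) = C x"
      using z by (simp add: dom.orth_proj_orth_compl[OF cl] bounded_op_diff[OF D])
    moreover have "orth_proj ip1 ?O z \<in> ?O"
      by (rule dom.orth_proj_in[OF dom.closed_subspace_orth_compl])
    moreover have "norm (orth_proj ip1 ?O z) \<le> L * norm x"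
      using dom.norm_orth_proj_le[OF dom.closed_subspace_orth_compl, of "null_space D" z] z by simp
    ultimately show ?thesis by blast
  qed
  then obtain X where X: "\<And>x. X x \<in> ?O" "\<And>x. D (X x) = C x" "\<And>x. norm (X x) \<le> L * norm x"
    by metis
  have "X (x + y) = X x + X y" for x y
    by (intro uniq dom.subspace_add[OF subO] X)
      (simp add: X bounded_op_add[OF D] bounded_op_add[OF C])
  moreover have "X (s1 c x) = s1 c (X x)" for c x
    by (intro uniq dom.subspace_scale[OF subO] X)
      (simp add: X bounded_op_scale[OF D] bounded_op_scale[OF C])
  ultimately have bop: "bounded_op s1 s1 X"
    using X(3) by (auto simp: bounded_op_def Vector_Spaces.linear_iff dom.vector_space_axioms)
  have "Z = X" unfolding Z_def douglas_solution_def
  proof (rule the_equality)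
    show "bounded_op s1 s1 X \<and> C = D \<circ> X \<and> range X \<subseteq> ?O" using bop X by auto
    fix X' assume X': "bounded_op s1 s1 X' \<and> C = D \<circ> X' \<and> range X' \<subseteq> ?O"
    show "X' = X"
    proof
      fix x
      have "C x = D (X' x)" using X' by (metis comp_apply)
      then show "X' x = X x" using X' X by (intro uniq) auto
    qed
  qed
  then show "bounded_op s1 s1 Z" "\<And>x. D (Z x) = C x" "\<And>x. Z x \<in> ?O" using bop X by auto
qed

end

section \<open>The Schur complement of a complementable operator\<close>

locale complementable_operator = hilbert_space_pair s1 ip1 s2 ip2
  for s1 :: "'k :: real_or_complex \<Rightarrow> 'a :: banach \<Rightarrow> 'a" and ip1 :: "'a \<Rightarrow> 'a \<Rightarrow> 'k"
    and s2 :: "'k \<Rightarrow> 'b :: banach \<Rightarrow> 'b" and ip2 :: "'b \<Rightarrow> 'b \<Rightarrow> 'k" +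
  fixes M :: "'a set" and N :: "'b set" and T :: "'a \<Rightarrow> 'b" and lam :: real
  assumes M: "closed_subspace s1 M" and N: "closed_subspace s2 N"
    and T: "bounded_op s1 s2 T"
    and lam_pos: "lam > 0"
    and compl: "complementable ip1 ip2 M N lam T"
begin

abbreviation "A \<equiv> op_block ip1 ip2 M N T"
abbreviation "B \<equiv> op_block ip1 ip2 (orth_compl ip1 M) N T"
abbreviation "C \<equiv> op_block ip1 ip2 M (orth_compl ip2 N) T"
abbreviation "D \<equiv> op_block ip1 ip2 (orth_compl ip1 M) (orth_compl ip2 N) T"
abbreviation "Z \<equiv> douglas_solution s1 s1 ip1 C D"
abbreviation "S \<equiv> schur_complement s1 ip1 ip2 M N T"

lemma bounded_op_blocks:
  "bounded_op s1 s2 A" "bounded_op s1 s2 B" "bounded_op s1 s2 C" "bounded_op s1 s2 D"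
  by (intro bounded_op_op_block M N T dom.closed_subspace_orth_compl cod.closed_subspace_orth_compl)+

text \<open>
  Complementability speaks of the unit ball of \<open>M\<close>; it is rescaled to \<open>M\<close> and then extended to the
  whole space through \<open>C x = C (P x)\<close>, where \<open>P\<close> is the projection onto \<open>M\<close>.
\<close>

lemma preimage_of_C_bounded: "\<exists>z. D z = C x \<and> norm z \<le> lam * norm x"
proof -
  define p where "p = orth_proj ip1 M x"
  have p: "p \<in> M" "norm p \<le> norm x" "C x = C p"
    using dom.orth_proj_in[OF M, of x] dom.norm_orth_proj_le[OF M, of x]
    by (auto simp: p_def op_block_def dom.orth_proj_id[OF M])
  show ?thesis
  proof (cases "p = 0")
    case True
    then show ?thesis
      using p lam_pos bounded_op_blocks by (intro exI[of _ 0]) (auto simp: bounded_op_zero)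
  next
    case False
    have "inverse (norm p) *\<^sub>R p \<in> unit_ball M"
      using False p by (simp add: unit_ball_def dom.closed_subspace_scaleR[OF M])
    then have "C (inverse (norm p) *\<^sub>R p) \<in> (\<lambda>y. lam *\<^sub>R y) ` D ` unit_ball (orth_compl ip1 M)"
      using compl by (auto simp: complementable_def Let_def)
    then obtain u where u: "C (inverse (norm p) *\<^sub>R p) = lam *\<^sub>R D u" "norm u \<le> 1"
      by (auto simp: unit_ball_def)
    have "C p = norm p *\<^sub>R C (inverse (norm p) *\<^sub>R p)"
      using False by (simp add: bounded_op_scaleR[OF bounded_op_blocks(3)])
    then have "D ((norm p * lam) *\<^sub>R u) = C x"
      using p u by (simp add: bounded_op_scaleR[OF bounded_op_blocks(4)])
    moreover have "norm ((norm p * lam) *\<^sub>R u) \<le> lam * norm x"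
    proof -
      have "norm p * lam * norm u \<le> norm x * lam * 1"
        using p u lam_pos by (intro mult_mono) auto
      then show ?thesis using lam_pos by (simp add: mult.commute)
    qed
    ultimately show ?thesis by blast
  qed
qed

lemmas Z_properties =
  douglas_solution_properties[OF bounded_op_blocks(3,4) preimage_of_C_bounded]

text \<open>
  The vector \<open>B (Z x)\<close> is normed by its own direction \<open>y\<close>, and \<open>B\<^sup>* y\<close> can be traded for \<open>\<lambda> D\<^sup>* w\<close>.
\<close>

lemma norm_block_douglas_le: "norm (B (Z x)) \<le> lam * norm (C x)"
proof (cases "B (Z x) = 0")
  case False
  define v where "v = B (Z x)"
  define y where "y = inverse (norm v) *\<^sub>R v"
  have "v \<in> N" using cod.orth_proj_in[OF N] by (simp add: v_def op_block_def)
  then have "y \<in> unit_ball N"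
    using False by (simp add: unit_ball_def y_def v_def cod.closed_subspace_scaleR[OF N])
  then have "adj ip1 ip2 B y \<in> (\<lambda>y. lam *\<^sub>R y) ` adj ip1 ip2 D ` unit_ball (orth_compl ip2 N)"
    using compl by (auto simp: complementable_def Let_def)
  then obtain w where w: "adj ip1 ip2 B y = lam *\<^sub>R adj ip1 ip2 D w" "norm w \<le> 1"
    by (auto simp: unit_ball_def)
  have "ip2 v y = of_real lam * ip1 (Z x) (adj ip1 ip2 D w)"
    by (simp add: v_def ip_adj[OF bounded_op_blocks(2)] w dom.ip_scaleR_right)
  also have "\<dots> = of_real lam * ip2 (C x) w"
    by (simp add: Z_properties(2) flip: ip_adj[OF bounded_op_blocks(4)])
  finally have "norm (ip2 v y) = lam * norm (ip2 (C x) w)"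
    using lam_pos by (simp add: norm_mult)
  moreover have "norm (ip2 (C x) w) \<le> norm (C x)"
    using cod.Cauchy_Schwarz[of "C x" w] mult_left_mono[OF w(2), of "norm (C x)"] by simp
  moreover have "norm (ip2 v y) = norm v"
    using False
    by (simp add: y_def v_def cod.ip_scaleR_right cod.ip_self norm_mult norm_inverse norm_power
        power2_eq_square)
  ultimately show ?thesis
    using mult_left_mono[of "norm (ip2 (C x) w)" "norm (C x)" lam] lam_pos by (simp add: v_def)
qed (use lam_pos in simp)

lemma schur_apply: "S x = A x - B (Z x)"
  by (simp add: schur_complement_def Let_def)

lemma norm_schur_le:
  assumes "x \<in> M"
  shows "norm (S x) \<le> (1 + lam) * norm (T x)"
proof -
  have AC: "norm (A x) \<le> norm (T x)" "norm (C x) \<le> norm (T x)"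
    using assms cod.norm_orth_proj_le[OF N, of "T x"]
      cod.norm_orth_proj_le[OF cod.closed_subspace_orth_compl, of N "T x"]
    by (simp_all add: op_block_def dom.orth_proj_id[OF M])
  have "norm (S x) \<le> norm (A x) + lam * norm (C x)"
    using norm_triangle_ineq4[of "A x" "B (Z x)"] norm_block_douglas_le[of x]
    by (simp add: schur_apply)
  moreover note AC(1)
  moreover have "lam * norm (C x) \<le> lam * norm (T x)"
    using AC(2) lam_pos by simp
  moreover have "(1 + lam) * norm (T x) = norm (T x) + lam * norm (T x)"
    by (simp add: distrib_right)
  ultimately show ?thesis by linarith
qed

lemma schur_add: "S (x + y) = S x + S y"
  by (simp add: schur_apply bounded_op_add[OF bounded_op_blocks(1)]
      bounded_op_add[OF bounded_op_blocks(2)] bounded_op_add[OF Z_properties(1)])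

lemma schur_scaleR: "S (r *\<^sub>R x) = r *\<^sub>R S x"
  using bounded_op_scale[OF Z_properties(1), of "of_real r" x]
  by (simp add: schur_apply bounded_op_scaleR[OF bounded_op_blocks(1)]
      bounded_op_scaleR[OF bounded_op_blocks(2)] dom.scale_of_real scaleR_right_diff_distrib)

text \<open>
  On the orthogonal complement of \<open>M\<close> the block \<open>C\<close> vanishes, so \<open>Z x\<close> is both a null vector of \<open>D\<close>
  and orthogonal to all of these.
\<close>

lemma schur_orth_compl_eq_0:
  assumes "x \<in> orth_compl ip1 M"
  shows "S x = 0"
proof -
  have P: "orth_proj ip1 M x = 0" by (rule dom.orth_proj_0[OF M assms])
  have "A x = A 0" "C x = C 0"
    using dom.orth_proj_0[OF M, of 0] by (simp_all add: op_block_def P orth_compl_def)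
  then have AC: "A x = 0" "C x = 0" using bounded_op_blocks by (auto simp: bounded_op_zero)
  then have "Z x \<in> null_space D" by (simp add: null_space_def Z_properties(2))
  then have "Z x = 0" using dom.orth_compl_Int Z_properties(3) by blast
  then show ?thesis by (simp add: schur_apply AC bounded_op_zero[OF bounded_op_blocks(2)])
qed

lemma M_orth_null_space_schur:
  assumes "bounded_below_on S M" and "x \<in> M"
  shows "x \<in> orth_compl ip1 (null_space S)"
proof -
  obtain c where c: "c > 0" "\<And>x. x \<in> M \<Longrightarrow> c * norm x \<le> norm (S x)"
    using assms by (auto simp: bounded_below_on_def)
  have "null_space S \<subseteq> orth_compl ip1 M"
  proof
    fix u assume u: "u \<in> null_space S"
    let ?p = "orth_proj ip1 M u"
    have "S (u - ?p) = 0" by (intro schur_orth_compl_eq_0 dom.orth_proj_residual[OF M])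
    then have "S ?p = 0" using u schur_add[of "u - ?p" ?p] by (simp add: null_space_def)
    then have "c * norm ?p \<le> 0" using c(2)[OF dom.orth_proj_in[OF M, of u]] by simp
    then have "?p = 0" using c(1) by (simp add: mult_le_0_iff)
    then show "u \<in> orth_compl ip1 M" using dom.orth_proj_residual[OF M, of u] by simp
  qed
  then show ?thesis
    using dom.mem_double_orth_compl[OF assms(2)] by (auto simp: orth_compl_def)
qed

end

theorem theorem3p6:
  fixes s1 :: "'k :: real_or_complex \<Rightarrow> 'a :: banach \<Rightarrow> 'a"
    and ip1 :: "'a \<Rightarrow> 'a \<Rightarrow> 'k"
    and s2 :: "'k \<Rightarrow> 'b :: banach \<Rightarrow> 'b"
    and ip2 :: "'b \<Rightarrow> 'b \<Rightarrow> 'k"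
    and M :: "'a set" and N :: "'b set"
    and T :: "'a \<Rightarrow> 'b" and lam :: real
  assumes "hilbert_space s1 ip1" and "hilbert_space s2 ip2"
    and "closed_subspace s1 M" and "closed_subspace s2 N"
    and "bounded_op s1 s2 T"
    and "lam > 0"
    and "complementable ip1 ip2 M N lam T"
    and "bounded_below_on (schur_complement s1 ip1 ip2 M N T) M"
  shows "bounded_below_on T M \<and>
    (\<forall>x\<in>M. reduced_min_modulus ip1 (schur_complement s1 ip1 ip2 M N T) / (1 + lam) * norm x
            \<le> norm (T x))"
proof -
  interpret complementable_operator s1 ip1 s2 ip2 M N T lam
    using assms
    by (simp add: complementable_operator_def complementable_operator_axioms_def
        hilbert_space_pair_def)
  obtain c where c: "c > 0" "\<And>x. x \<in> M \<Longrightarrow> c * norm x \<le> norm (S x)"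
    using assms(8) by (auto simp: bounded_below_on_def)
  have lower: "g / (1 + lam) * norm x \<le> norm (T x)" if "x \<in> M" "g * norm x \<le> norm (S x)" for g x
    using norm_schur_le[OF that(1)] that(2) lam_pos by (simp add: field_simps)
  have "bounded_below_on T M"
    unfolding bounded_below_on_def
    using c lam_pos by (intro exI[of _ "c / (1 + lam)"] conjI ballI lower) auto
  moreover have "reduced_min_modulus ip1 S / (1 + lam) * norm x \<le> norm (T x)" if "x \<in> M" for x
    using M_orth_null_space_schur[OF assms(8) that] that
    by (intro lower dom.reduced_min_modulus_le schur_scaleR)
  ultimately show ?thesis by blast
qed

end
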